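(* Let $\mathcal{C}$ be an arbitrary $((n,K,d))_m$ quantum code, let $P=\sum_{i=1}^K|v_i\rangle\langle v_i|$ be the orthogonal projection onto $\mathcal{C}$, where $\{v_i\}$ is an orthonormal basis of $\mathcal{C}$, and let $G$ be the (Abelian) index group of any nice error basis $\mathcal{E}=\{E_g\mid g\in G\}$ of the quantum system $\mathbb{C}^m$ with $m$ levels. For $g\in G^n$ put $$c_g=\frac{1}{K^2}\,(\operatorname{tr}E_gP^\dagger)(\operatorname{tr}E_g^\dagger P)=\frac{1}{K^2}\Big|\sum_{i=1}^K\langle v_i|E_g|v_i\rangle\Big|^2 .$$ Let $C=\sum_{g\in G^n}c_gz^g\in\mathbb{C}Z$ be the element associated with $\mathcal{C}$, let $M=\sum_{g\in G^n}c_g$, and let $C'=\sum_{h\in G^n}c'_hz^h$ be the transform of $C$. Then: 1) the dimension $K$ of $\mathcal{C}$ equals $m^n/M$; 2) the minimum distance $d$ of $\mathcal{C}$ equals the minimum weight $\operatorname{wt}(g)$ of $g\in G^n$ such that $c_g\neq c'_g$ if $K>1$; and equals the minimum nonzero weight $\operatorname{wt}(g)$ of $g\in G^n$ such that $c_g\neq 0$ if $K=1$.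
   Context: Quantum code: an $((n,K,d))_m$ quantum code is a $K$-dimensional subspace of the state space $(\mathbb{C}^m)^{\otimes n}$ of $n$ quantum systems with $m$ levels that can detect all errors affecting less than $d$ quantum systems, but cannot detect some errors affecting $d$ quantum systems; $d$ is called its minimum distance. Here "detect" has its usual meaning in quantum error correction: the code with projection $P$ detects an operator $E$ if $PEP=\lambda P$ for some $\lambda\in\mathbb{C}$. Nice error basis: let $G$ be an additively written group of order $m^2$ with identity $0$, assumed Abelian. A nice error basis of $\mathbb{C}^m$ with index group $G$ is a set $\mathcal{E}=\{E_g\mid g\in G\}$ of unitary operators on $\mathbb{C}^m$ such that (i) $E_0$ is the identity operator; (ii) $\operatorname{tr}E_g=m\,\delta_{g,0}$ for all $g\in G$; (iii) $E_gE_h=\omega_{gh}E_{g+h}$ for all $g,h\in G$, where the complex numbers $\omega_{gh}$ have modulus 1. For $g=(g_1,\dots,g_n)\in G^n$ write $E_g=E_{g_1}\otimes\cdots\otimes E_{g_n}$, an operator on $(\mathbb{C}^m)^{\otimes n}$. Group algebra and transform: $Z=\{z^g\mid g\in G^n\}$ is the group isomorphic to $G^n$, written multiplicatively with $z^gz^h=z^{g+h}$, and $\mathbb{C}Z$ is its group algebra over $\mathbb{C}$. For $h\in G^n$ let $\chi_h(z^g)=\operatorname{tr}(E_h^\dagger E_g^\dagger E_hE_g)/m^n$, extended to $\mathbb{C}Z$ by linearity. For $C=\sum_{g\in G^n} c_gz^g\in\mathbb{C}Z$ with $M=\sum_{g\in G^n} c_g\neq0$, the transform of $C$ is $C'=\frac1M\sum_{h\in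 G^n}\chi_h(C)z^h$, i.e. $C'=\sum_{h\in G^n} c'_hz^h$ with $c'_h=\frac1M\chi_h(C)$. Weight: $\operatorname{wt}(g)$ is the number of nonzero components of $g\in G^n$. *)

theory Defs
  imports "HOL-Analysis.Analysis" "HOL-Library.Poly_Mapping"
begin

text \<open>
  The levels of one system form the finite type \<open>'m\<close> and the systems are indexed by the
  finite type \<open>'n\<close>, so \<open>m = CARD('m)\<close> and \<open>n = CARD('n)\<close>.  The computational basis of
  the \<open>n\<close>-fold tensor power of \<open>\<complex>\<^sup>m\<close> is indexed by the words \<open>'m ^ 'n\<close>; operators are
  identified with their matrices in this basis.
\<close>

type_synonym ('m, 'n) state = "complex ^ ('m ^ 'n)"
type_synonym ('m, 'n) operator = "(complex ^ ('m ^ 'n)) ^ ('m ^ 'n)"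

text \<open>Conjugate-linear in the first argument, as in Dirac notation.\<close>

definition braket :: "complex ^ 'a \<Rightarrow> complex ^ 'a \<Rightarrow> complex" where
  "braket v w = (\<Sum>x\<in>UNIV. cnj (v $ x) * w $ x)"

definition ketbra :: "complex ^ 'a \<Rightarrow> complex ^ 'a \<Rightarrow> complex ^ 'a ^ 'a" where
  "ketbra v w = (\<chi> x y. v $ x * cnj (w $ y))"

definition dagger :: "complex ^ 'a ^ 'a \<Rightarrow> complex ^ 'a ^ 'a"  ("_\<^sup>\<dagger>" [1000] 999) where
  "A\<^sup>\<dagger> = (\<chi> x y. cnj (A $ y $ x))"

definition scale_op :: "complex \<Rightarrow> complex ^ 'a ^ 'a \<Rightarrow> complex ^ 'a ^ 'a"  (infixr "\<cdot>" 75) where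
  "c \<cdot> A = (\<chi> x y. c * A $ x $ y)"

definition unitary :: "complex ^ 'a ^ 'a \<Rightarrow> bool" where
  "unitary U \<longleftrightarrow> U\<^sup>\<dagger> ** U = mat 1 \<and> U ** U\<^sup>\<dagger> = mat 1"

definition tensor_op :: "('n \<Rightarrow> complex ^ 'm ^ 'm) \<Rightarrow> ('m::finite, 'n::finite) operator" where
  "tensor_op A = (\<chi> x y. \<Prod>i\<in>UNIV. A i $ (x $ i) $ (y $ i))"

definition orthonormal_basis ::
    "(nat \<Rightarrow> complex ^ 'a) \<Rightarrow> nat \<Rightarrow> (complex ^ 'a) set \<Rightarrow> bool" where
  "orthonormal_basis v K S \<longleftrightarrow>
     (\<forall>i<K. \<forall>j<K. braket (v i) (v j) = (if i = j then 1 else 0)) \<and> vec.span (v ` {..<K}) = S"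

definition is_orthogonal_projection :: "complex ^ 'a ^ 'a \<Rightarrow> (complex ^ 'a) set \<Rightarrow> bool" where
  "is_orthogonal_projection P S \<longleftrightarrow> P\<^sup>\<dagger> = P \<and> P ** P = P \<and> range (\<lambda>x. P *v x) = S"

definition orthogonal_projection :: "(complex ^ 'a) set \<Rightarrow> complex ^ 'a ^ 'a" where
  "orthogonal_projection S = (THE P. is_orthogonal_projection P S)"

text \<open>
  \<open>E\<close> acts only on the systems in \<open>S\<close> if it is of the form \<open>A \<otimes> I\<close>, where \<open>A\<close> is an
  operator on the systems in \<open>S\<close> (whose basis is indexed by words restricted to \<open>S\<close>)
  and \<open>I\<close> is the identity on the remaining ones.
\<close>

definition acts_only_on :: "'n set \<Rightarrow> ('m::finite, 'n::finite) operator \<Rightarrow> bool" where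
  "acts_only_on S E \<longleftrightarrow>
     (\<exists>A. \<forall>x y. E $ x $ y =
        (if \<forall>i. i \<notin> S \<longrightarrow> x $ i = y $ i
         then A (restrict (($) x) S) (restrict (($) y) S) else 0))"

definition detects :: "('m::finite, 'n::finite) state set \<Rightarrow> ('m, 'n) operator \<Rightarrow> bool" where
  "detects Q E \<longleftrightarrow>
     (let P = orthogonal_projection Q in \<exists>\<mu>. P ** E ** P = \<mu> \<cdot> P)"

text \<open>
  If \<open>dim Q = 1\<close>, then every operator satisfies \<open>P E P = \<mu> P\<close> for some \<open>\<lambda>\<close>, so this
  condition cannot determine a minimum distance.  The usual convention for one-dimensional
  codes is to require purity, that is, \<open>\<mu>\<close> must be the normalized trace of \<open>E\<close>:
  traceless errors must map the code to its orthogonal complement.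
\<close>

definition detects_purely :: "('m::finite, 'n::finite) state set \<Rightarrow> ('m, 'n) operator \<Rightarrow> bool" where
  "detects_purely Q E \<longleftrightarrow>
     (let P = orthogonal_projection Q
      in P ** E ** P = (trace E / of_nat (CARD('m) ^ CARD('n))) \<cdot> P)"

text \<open>
  \<open>Q\<close> is an \<open>((n, K, d))\<^sub>m\<close> code.  Errors with \<open>card S = d\<close> are allowed to act trivially on
  some systems in \<open>S\<close>; by the preceding condition, an undetected one does not.
\<close>

definition quantum_code :: "('m::finite, 'n::finite) state set \<Rightarrow> nat \<Rightarrow> nat \<Rightarrow> bool" where
  "quantum_code Q K d \<longleftrightarrow>
     vec.subspace Q \<and> vec.dim Q = K \<and>
     (let detectable = (if K = 1 then detects_purely Q else detects Q) in
       (\<forall>S E. card S < d \<and> acts_only_on S E \<longrightarrow> detectable E) \<and>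
       (\<exists>S E. card S = d \<and> acts_only_on S E \<and> \<not> detectable E))"

definition nice_error_basis ::
    "('g::{ab_group_add, finite} \<Rightarrow> complex ^ 'm ^ 'm::finite) \<Rightarrow> bool" where
  "nice_error_basis E \<longleftrightarrow>
     CARD('g) = CARD('m) ^ 2 \<and>
     (\<forall>g. unitary (E g)) \<and>
     E 0 = mat 1 \<and>
     (\<forall>g. trace (E g) = (if g = 0 then of_nat CARD('m) else 0)) \<and>
     (\<forall>g h. \<exists>\<omega>. cmod \<omega> = 1 \<and> E g ** E h = \<omega> \<cdot> E (g + h))"

definition error_op :: "('g \<Rightarrow> complex ^ 'm ^ 'm) \<Rightarrow> 'g ^ 'n \<Rightarrow> ('m::finite, 'n::finite) operator" where
  "error_op E g = tensor_op (\<lambda>i. E (g $ i))"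

definition wt :: "('g::zero) ^ 'n \<Rightarrow> nat" where
  "wt g = card {i. g $ i \<noteq> 0}"

text \<open>
  The elements of the group algebra over \<open>\<complex>\<close> are the finitely supported functions on the
  additive group \<open>'g ^ 'n\<close>; multiplication of \<open>\<Rightarrow>\<^sub>0\<close> is convolution, so
  \<open>zpow g * zpow h = zpow (g + h)\<close>.
\<close>

type_synonym ('g, 'n) group_algebra = "('g ^ 'n) \<Rightarrow>\<^sub>0 complex"

definition zpow :: "'g ^ 'n \<Rightarrow> ('g, 'n) group_algebra" where
  "zpow g = Poly_Mapping.single g 1"

definition scale_alg ::
    "complex \<Rightarrow> ('g, 'n) group_algebra \<Rightarrow> ('g, 'n) group_algebra"  (infixr "\<odot>" 75) where
  "a \<odot> C = Poly_Mapping.map ((*) a) C"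

definition group_char ::
    "('g \<Rightarrow> complex ^ 'm ^ 'm) \<Rightarrow> 'g ^ 'n::finite \<Rightarrow> 'g ^ 'n \<Rightarrow> complex" where
  "group_char E h g =
     trace ((error_op E h)\<^sup>\<dagger> ** (error_op E g)\<^sup>\<dagger> ** error_op E h ** error_op E g)
       / of_nat (CARD('m::finite) ^ CARD('n))"

definition char_alg ::
    "('g::finite \<Rightarrow> complex ^ 'm::finite ^ 'm) \<Rightarrow> 'g ^ 'n::finite \<Rightarrow> ('g, 'n) group_algebra \<Rightarrow> complex" where
  "char_alg E h C = (\<Sum>g\<in>UNIV. Poly_Mapping.lookup C g * group_char E h g)"

definition coeff_sum :: "('g::finite, 'n::finite) group_algebra \<Rightarrow> complex" where
  "coeff_sum C = (\<Sum>g\<in>UNIV. Poly_Mapping.lookup C g)"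

definition transform ::
    "('g::finite \<Rightarrow> complex ^ 'm::finite ^ 'm) \<Rightarrow> ('g, 'n::finite) group_algebra \<Rightarrow> ('g, 'n) group_algebra" where
  "transform E C = (1 / coeff_sum C) \<odot> (\<Sum>h\<in>UNIV. char_alg E h C \<odot> zpow h)"

definition is_minimum :: "nat \<Rightarrow> nat set \<Rightarrow> bool" where
  "is_minimum d A \<longleftrightarrow> d \<in> A \<and> (\<forall>k\<in>A. d \<le> k)"

end

theory Submission
  imports Defs
begin

text \<open>
  The operators \<open>E\<^sub>g\<close> are an orthogonal basis for the Hilbert--Schmidt inner product, and
  \<open>E\<^sub>h\<^sup>\<dagger> E\<^sub>g\<^sup>\<dagger> E\<^sub>h = \<chi>\<^sub>h(z\<^sup>g) E\<^sub>g\<^sup>\<dagger>\<close>.  Parseval's identity therefore gives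
  \<open>M = m\<^sup>n / K\<close> and \<open>c'\<^sub>h = tr (P E\<^sub>h P E\<^sub>h\<^sup>\<dagger>) / K\<close>.  The difference \<open>c'\<^sub>h - c\<^sub>h\<close> is, up to the factor
  \<open>1 / K\<close>, the squared distance of \<open>P E\<^sub>h P\<close> from the multiples of \<open>P\<close>, so it vanishes
  exactly when \<open>E\<^sub>h\<close> is detected; for \<open>K = 1\<close> and \<open>h \<noteq> 0\<close>, one has \<open>P E\<^sub>h P = tr (E\<^sub>h P) P\<close>,
  and \<open>E\<^sub>h\<close> is purely detected exactly when \<open>c\<^sub>h = 0\<close>.  Detectability is a linear condition,
  and an operator acting only on the systems in \<open>S\<close> is a linear combination of those
  \<open>E\<^sub>g\<close> with \<open>g\<close> supported in \<open>S\<close>, so the minimum distance can be read off the error basis.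
\<close>

section \<open>Matrix algebra: adjoints, scalar multiples and traces\<close>

lemma dagger_nth [simp]: "A\<^sup>\<dagger> $ x $ y = cnj (A $ y $ x)"
  by (simp add: dagger_def)

lemma scale_op_nth [simp]: "(c \<cdot> A) $ x $ y = c * A $ x $ y"
  by (simp add: scale_op_def)

lemma matrix_mult_nth:
  fixes A B :: "complex ^ 'a ^ 'a::finite"
  shows "(A ** B) $ x $ y = (\<Sum>z\<in>UNIV. A $ x $ z * B $ z $ y)"
  by (simp add: matrix_matrix_mult_def)

lemma dagger_mult: "(A ** B)\<^sup>\<dagger> = B\<^sup>\<dagger> ** A\<^sup>\<dagger>"
  for A B :: "complex ^ 'a ^ 'a::finite"
  by (simp add: vec_eq_iff matrix_mult_nth mult.commute)

lemma dagger_scale: "(c \<cdot> A)\<^sup>\<dagger> = cnj c \<cdot> A\<^sup>\<dagger>"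
  by (simp add: vec_eq_iff)

lemma dagger_diff: "(A - B)\<^sup>\<dagger> = A\<^sup>\<dagger> - B\<^sup>\<dagger>"
  by (simp add: vec_eq_iff)

lemma scale_op_scale_op [simp]: "a \<cdot> (b \<cdot> A) = (a * b) \<cdot> A"
  by (simp add: vec_eq_iff)

lemma scale_op_one [simp]: "1 \<cdot> A = A"
  by (simp add: vec_eq_iff)

lemma scale_diff: "c \<cdot> (A - B) = c \<cdot> A - c \<cdot> B"
  by (simp add: vec_eq_iff right_diff_distrib)

lemma scale_mult_left: "(c \<cdot> A) ** B = c \<cdot> (A ** B)"
  for A B :: "complex ^ 'a ^ 'a::finite"
  by (simp add: vec_eq_iff matrix_mult_nth sum_distrib_left mult.assoc)

lemma scale_mult_right: "A ** (c \<cdot> B) = c \<cdot> (A ** B)"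
  for A B :: "complex ^ 'a ^ 'a::finite"
  by (simp add: vec_eq_iff matrix_mult_nth sum_distrib_left mult_ac)

lemma trace_scale: "trace (c \<cdot> A) = c * trace A"
  for A :: "complex ^ 'a ^ 'a::finite"
  by (simp add: trace_def sum_distrib_left)

lemma trace_dagger: "trace (A\<^sup>\<dagger>) = cnj (trace A)"
  for A :: "complex ^ 'a ^ 'a::finite"
  by (simp add: trace_def)

lemma trace_mat_1: "trace (mat 1 :: complex ^ 'a ^ 'a::finite) = of_nat CARD('a)"
  by (simp add: trace_def mat_def)

text \<open>The trace is the sum of the squared moduli of the entries, the squared Hilbert-Schmidt
  norm.\<close>

lemma trace_dagger_mult_self_eq_0:
  fixes A :: "complex ^ 'a ^ 'a::finite"
  assumes "trace (A\<^sup>\<dagger> ** A) = 0"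
  shows "A = 0"
proof -
  have "trace (A\<^sup>\<dagger> ** A) = of_real (\<Sum>x\<in>UNIV. \<Sum>z\<in>UNIV. (cmod (A $ z $ x))\<^sup>2)"
    by (simp add: trace_def matrix_mult_nth complex_norm_square mult.commute del: of_real_power)
  with assms have "(\<Sum>x\<in>UNIV. \<Sum>z\<in>UNIV. (cmod (A $ z $ x))\<^sup>2) = 0"
    by (metis of_real_eq_0_iff)
  hence "\<forall>x z. A $ z $ x = 0"
    by (simp add: sum_nonneg_eq_0_iff sum_nonneg)
  thus ?thesis by (simp add: vec_eq_iff)
qed

section \<open>Tensor products of operators\<close>

text \<open>Distributivity, with words read as dependent functions. Letting \<open>X i\<close> vary
  with \<open>i\<close> also covers group words that must vanish outside a set of positions.\<close>

lemma sum_words_prod: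
  fixes f :: "'n::finite \<Rightarrow> 'a::finite \<Rightarrow> complex"
  shows "(\<Sum>x\<in>{x :: 'a ^ 'n. \<forall>i. x $ i \<in> X i}. \<Prod>i\<in>UNIV. f i (x $ i)) = (\<Prod>i\<in>UNIV. \<Sum>a\<in>X i. f i a)"
proof -
  have "bij_betw vec_nth {x :: 'a ^ 'n. \<forall>i. x $ i \<in> X i} (PiE UNIV X)"
    by (rule bij_betw_byWitness[where f' = vec_lambda]) (auto simp: PiE_def)
  hence "(\<Sum>x\<in>{x :: 'a ^ 'n. \<forall>i. x $ i \<in> X i}. \<Prod>i\<in>UNIV. f i (x $ i))
      = (\<Sum>p\<in>PiE UNIV X. \<Prod>i\<in>UNIV. f i (p i))"
    by (intro sum.reindex_bij_betw)
  also have "\<dots> = (\<Prod>i\<in>UNIV. \<Sum>a\<in>X i. f i a)"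
    by (rule prod_sum_PiE [symmetric]) auto
  finally show ?thesis .
qed

lemma sum_words_prod_UNIV:
  fixes f :: "'n::finite \<Rightarrow> 'a::finite \<Rightarrow> complex"
  shows "(\<Sum>x\<in>(UNIV :: ('a ^ 'n) set). \<Prod>i\<in>UNIV. f i (x $ i)) = (\<Prod>i\<in>UNIV. \<Sum>a\<in>UNIV. f i a)"
  using sum_words_prod[where X = "\<lambda>_. UNIV" and f = f] by simp

lemma prod_delta_words:
  "(\<Prod>i\<in>UNIV. if x $ i = y $ i then (1::complex) else 0) = (if x = y then 1 else 0)"
  for x y :: "'a ^ 'n::finite"
  by (auto simp: vec_eq_iff prod_zero_iff)

lemma tensor_op_mult: "tensor_op A ** tensor_op B = tensor_op (\<lambda>i. A i ** B i)"
  by (simp add: vec_eq_iff tensor_op_def matrix_matrix_mult_def prod.distrib [symmetric]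
      sum_words_prod_UNIV [of "\<lambda>i a. A i $ (_ $ i) $ a * B i $ a $ (_ $ i)"])

lemma tensor_op_dagger: "(tensor_op A)\<^sup>\<dagger> = tensor_op (\<lambda>i. (A i)\<^sup>\<dagger>)"
  by (simp add: vec_eq_iff tensor_op_def)

lemma tensor_op_scale: "tensor_op (\<lambda>i. w i \<cdot> A i) = (\<Prod>i\<in>UNIV. w i) \<cdot> tensor_op A"
  by (simp add: vec_eq_iff tensor_op_def prod.distrib)

lemma tensor_op_mat_1: "tensor_op (\<lambda>_. mat 1) = mat 1"
  by (simp add: vec_eq_iff tensor_op_def mat_def prod_delta_words)

lemma trace_tensor_op: "trace (tensor_op A) = (\<Prod>i\<in>UNIV. trace (A i))"
  using sum_words_prod_UNIV[of "\<lambda>i a. A i $ a $ a"] by (simp add: trace_def tensor_op_def)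

section \<open>Orthogonality and completeness of a nice error basis\<close>

text \<open>Up to a phase, \<open>E h\<close> is \<open>E g ** E (h - g)\<close>, so the product
  under the trace is a multiple of \<open>E (h - g)\<close>, which is traceless for
  \<open>g \<noteq> h\<close>.\<close>

lemma neb_orthogonal:
  fixes E :: "'g::{ab_group_add, finite} \<Rightarrow> complex ^ 'm ^ 'm::finite"
  assumes "nice_error_basis E"
  shows "trace ((E g)\<^sup>\<dagger> ** E h) = (if g = h then of_nat CARD('m) else 0)"
proof -
  have U: "(E g)\<^sup>\<dagger> ** E g = mat 1"
    using assms by (simp add: nice_error_basis_def unitary_def)
  obtain w where w: "cmod w = 1" "E g ** E (h - g) = w \<cdot> E (g + (h - g))"
    using assms unfolding nice_error_basis_def by blast
  have "E h = inverse w \<cdot> (E g ** E (h - g))"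
    using w by (cases "w = 0") auto
  hence "(E g)\<^sup>\<dagger> ** E h = inverse w \<cdot> E (h - g)"
    by (simp add: scale_mult_right matrix_mul_assoc U)
  thus ?thesis
    using assms U
    by (cases "g = h") (simp_all only: trace_scale nice_error_basis_def trace_mat_1 right_minus_eq
        if_True if_False mult_zero_right eq_commute[of h g] refl)
qed

text \<open>
  Orthogonality says that the rows of the matrix indexed by \<open>'g\<close> and \<open>'m \<times> 'm\<close> are
  orthogonal; this matrix is square, so its columns are orthogonal, too.
\<close>

lemma neb_complete:
  fixes E :: "'g::{ab_group_add, finite} \<Rightarrow> complex ^ 'm ^ 'm::finite"
  assumes "nice_error_basis E"
  shows "(\<Sum>g\<in>UNIV. E g $ x $ y * cnj (E g $ u $ w)) = (if x = u \<and> y = w then of_nat CARD('m) else 0)"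
proof -
  have "card (UNIV :: ('m \<times> 'm) set) = card (UNIV :: 'g set)"
    using assms by (simp add: nice_error_basis_def power2_eq_square)
  then obtain f :: "'m \<times> 'm \<Rightarrow> 'g" where f: "bij f"
    using finite_same_card_bij[of "UNIV :: ('m \<times> 'm) set" "UNIV :: 'g set"] by auto
  define m :: complex where "m = of_nat CARD('m)"
  have m: "m \<noteq> 0" by (simp add: m_def)
  define A :: "complex ^ ('m \<times> 'm) ^ ('m \<times> 'm)"
    where "A = (\<chi> p q. E (f p) $ fst q $ snd q)"
  \<comment> \<open>The conjugate transpose of \<open>A\<close> divided by m: orthogonality of the
    rows becomes \<open>A ** B = mat 1\<close>, that of the columns
    \<open>B ** A = mat 1\<close>.\<close>
  define B :: "complex ^ ('m \<times> 'm) ^ ('m \<times> 'm)"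
    where "B = (\<chi> q p. cnj (E (f p) $ fst q $ snd q) / m)"
  have "(A ** B) $ p $ r = (if p = r then 1 else 0)" for p r
  proof -
    have "(A ** B) $ p $ r
        = (\<Sum>q\<in>UNIV \<times> UNIV. cnj (E (f r) $ fst q $ snd q) * E (f p) $ fst q $ snd q) / m"
      by (simp add: A_def B_def matrix_matrix_mult_def sum_divide_distrib mult.commute)
    also have "\<dots> = (\<Sum>a\<in>UNIV. \<Sum>b\<in>UNIV. cnj (E (f r) $ a $ b) * E (f p) $ a $ b) / m"
      by (simp only: sum.cartesian_product) (simp add: case_prod_beta)
    also have "\<dots> = trace ((E (f r))\<^sup>\<dagger> ** E (f p)) / m"
      by (subst sum.swap) (simp add: trace_def matrix_mult_nth)
    also have "\<dots> = (if p = r then 1 else 0)"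
      using f m by (auto simp: neb_orthogonal [OF assms] m_def bij_def dest: injD)
    finally show ?thesis .
  qed
  hence "A ** B = mat 1" by (simp add: vec_eq_iff mat_def)
  hence "B ** A = mat 1" by (simp add: matrix_left_right_inverse)
  hence "(B ** A) $ (u, w) $ (x, y) = (if x = u \<and> y = w then 1 else 0)"
    by (auto simp: mat_def)
  moreover have "(B ** A) $ (u, w) $ (x, y) =
      (\<Sum>p\<in>UNIV. E (f p) $ x $ y * cnj (E (f p) $ u $ w)) / m"
    by (simp add: A_def B_def matrix_matrix_mult_def sum_divide_distrib mult.commute)
  moreover have "(\<Sum>p\<in>UNIV. E (f p) $ x $ y * cnj (E (f p) $ u $ w))
      = (\<Sum>g\<in>UNIV. E g $ x $ y * cnj (E g $ u $ w))"
    using f by (rule sum.reindex_bij_betw)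
  ultimately have "(\<Sum>g\<in>UNIV. E g $ x $ y * cnj (E g $ u $ w)) / m = (if x = u \<and> y = w then 1 else 0)"
    by simp
  thus ?thesis using m by (simp only: m_def divide_eq_eq simp_thms if_False) auto
qed

section \<open>Error operators on n systems\<close>

lemma error_op_nth: "error_op E g $ x $ y = (\<Prod>i\<in>UNIV. E (g $ i) $ (x $ i) $ (y $ i))"
  by (simp add: error_op_def tensor_op_def)

lemma error_op_zero: "nice_error_basis E \<Longrightarrow> error_op E 0 = mat 1"
  by (simp add: error_op_def nice_error_basis_def tensor_op_mat_1)

lemma error_op_unitary:
  assumes "nice_error_basis E"
  shows "(error_op E g)\<^sup>\<dagger> ** error_op E g = mat 1" "error_op E g ** (error_op E g)\<^sup>\<dagger> = mat 1"
  using assms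
  by (simp_all add: error_op_def tensor_op_dagger tensor_op_mult nice_error_basis_def
      unitary_def tensor_op_mat_1)

lemma error_op_mult:
  assumes "nice_error_basis E"
  obtains w where "w \<noteq> 0" "error_op E g ** error_op E h = w \<cdot> error_op E (g + h)"
proof -
  have "\<forall>i. \<exists>w. cmod w = 1 \<and> E (g $ i) ** E (h $ i) = w \<cdot> E (g $ i + h $ i)"
    using assms by (auto simp: nice_error_basis_def)
  then obtain w where w: "\<And>i. cmod (w i) = 1"
    "\<And>i. E (g $ i) ** E (h $ i) = w i \<cdot> E (g $ i + h $ i)" by metis
  have "error_op E g ** error_op E h = (\<Prod>i\<in>UNIV. w i) \<cdot> error_op E (g + h)"
    by (simp add: error_op_def tensor_op_mult w(2) tensor_op_scale)
  moreover have "(\<Prod>i\<in>UNIV. w i) \<noteq> 0"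
    using w(1) by (metis norm_zero prod_zero_iff finite zero_neq_one)
  ultimately show ?thesis using that by blast
qed

lemma trace_error_op:
  fixes g :: "'g::{ab_group_add, finite} ^ 'n::finite"
  assumes "nice_error_basis E" "g \<noteq> 0"
  shows "trace (error_op E g) = 0"
proof -
  obtain i where "g $ i \<noteq> 0" using assms(2) by (auto simp: vec_eq_iff)
  thus ?thesis using assms(1)
    by (auto simp: error_op_def trace_tensor_op nice_error_basis_def intro!: bexI[of _ i])
qed

text \<open>As the index group is Abelian, both products of two error operators are multiples of the
  same operator, so they commute up to a scalar \<open>a / b\<close>. Taking a trace identifies this
  scalar as the character value.\<close>

lemma error_op_conj:
  fixes E :: "'g::{ab_group_add, finite} \<Rightarrow> complex ^ 'm ^ 'm::finite"
    and h g :: "'g ^ 'n::finite"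
  assumes neb: "nice_error_basis E"
  shows "(error_op E h)\<^sup>\<dagger> ** (error_op E g)\<^sup>\<dagger> ** error_op E h
     = group_char E h g \<cdot> (error_op E g)\<^sup>\<dagger>"
proof -
  let ?H = "error_op E h" and ?G = "error_op E g"
  obtain a where a: "a \<noteq> 0" "?H ** ?G = a \<cdot> error_op E (h + g)" using error_op_mult[OF neb] .
  obtain b where b: "b \<noteq> 0" "?G ** ?H = b \<cdot> error_op E (g + h)" using error_op_mult[OF neb] .
  have "?H ** ?G = (a / b) \<cdot> (?G ** ?H)"
    using a b by (simp add: add.commute)
  hence "?H\<^sup>\<dagger> ** ?G\<^sup>\<dagger> ** (?H ** ?G) = (a / b) \<cdot> (?H\<^sup>\<dagger> ** (?G\<^sup>\<dagger> ** ?G) ** ?H)"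
    by (simp add: scale_mult_right matrix_mul_assoc)
  hence *: "?H\<^sup>\<dagger> ** ?G\<^sup>\<dagger> ** ?H ** ?G = (a / b) \<cdot> mat 1"
    by (simp add: error_op_unitary[OF neb] matrix_mul_assoc)
  have "group_char E h g = a / b"
    unfolding group_char_def * by (simp add: trace_scale trace_mat_1)
  \<comment> \<open>Multiplying by the adjoint on the right cancels the last factor by
    unitarity.\<close>
  moreover have "?H\<^sup>\<dagger> ** ?G\<^sup>\<dagger> ** ?H ** ?G ** ?G\<^sup>\<dagger> = (a / b) \<cdot> ?G\<^sup>\<dagger>"
    unfolding * by (simp add: scale_mult_left)
  moreover have "?H\<^sup>\<dagger> ** ?G\<^sup>\<dagger> ** ?H ** ?G ** ?G\<^sup>\<dagger> = ?H\<^sup>\<dagger> ** ?G\<^sup>\<dagger> ** ?H"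
    by (simp add: matrix_mul_assoc[symmetric] error_op_unitary[OF neb])
  ultimately show ?thesis by simp
qed

section \<open>Completeness, expansion of local operators and Parseval's identity\<close>

text \<open>The sum factors over the systems: positions in \<open>S\<close> contribute single-system
  completeness, and the others only the identity \<open>E 0\<close>. The result is the kernel of m^n
  times the Hilbert-Schmidt projection onto operators of the form A tensor I.\<close>

lemma error_op_complete_on:
  fixes E :: "'g::{ab_group_add, finite} \<Rightarrow> complex ^ 'm ^ 'm::finite"
    and x y u w :: "'m ^ 'n::finite"
  assumes "nice_error_basis E"
  shows "(\<Sum>g\<in>{g. \<forall>i. i \<notin> S \<longrightarrow> g $ i = 0}. error_op E g $ x $ y * cnj (error_op E g $ u $ w))
    = (\<Prod>i\<in>UNIV. if i \<in> S then (if x $ i = u $ i \<and> y $ i = w $ i then of_nat CARD('m) else 0)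
        else (if x $ i = y $ i \<and> u $ i = w $ i then 1 else 0))"
proof -
  let ?X = "\<lambda>i. if i \<in> S then UNIV else {0 :: 'g}"
  have "{g :: 'g ^ 'n. \<forall>i. i \<notin> S \<longrightarrow> g $ i = 0} = {g. \<forall>i. g $ i \<in> ?X i}"
    by auto
  hence "(\<Sum>g\<in>{g. \<forall>i. i \<notin> S \<longrightarrow> g $ i = 0}. error_op E g $ x $ y * cnj (error_op E g $ u $ w))
    = (\<Sum>g\<in>{g. \<forall>i. g $ i \<in> ?X i}. \<Prod>i\<in>UNIV. E (g $ i) $ (x $ i) $ (y $ i) * cnj (E (g $ i) $ (u $ i) $ (w $ i)))"
    by (simp add: error_op_nth prod.distrib)
  also have "\<dots> = (\<Prod>i\<in>UNIV. \<Sum>a\<in>?X i. E a $ (x $ i) $ (y $ i) * cnj (E a $ (u $ i) $ (w $ i)))"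
    by (rule sum_words_prod)
  also have "\<dots> = (\<Prod>i\<in>UNIV. if i \<in> S then (if x $ i = u $ i \<and> y $ i = w $ i then of_nat CARD('m) else 0)
        else (if x $ i = y $ i \<and> u $ i = w $ i then 1 else 0))"
    using assms by (intro prod.cong) (auto simp: neb_complete[OF assms] nice_error_basis_def mat_def)
  finally show ?thesis .
qed

lemma acts_only_on_expansion:
  fixes E :: "'g::{ab_group_add, finite} \<Rightarrow> complex ^ 'm ^ 'm::finite"
    and F :: "('m, 'n::finite) operator"
  assumes neb: "nice_error_basis E" and F: "acts_only_on S F"
  obtains a where "F = (\<Sum>g\<in>{g. \<forall>i. i \<notin> S \<longrightarrow> g $ i = 0}. a g \<cdot> error_op E g)"
proof -
  define N :: complex where "N = of_nat CARD('m) ^ CARD('n)"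
  have N: "N \<noteq> 0" by (simp add: N_def)
  let ?G = "{g :: 'g ^ 'n. \<forall>i. i \<notin> S \<longrightarrow> g $ i = 0}"
  \<comment> \<open>The Hilbert-Schmidt inner products of the error operators with \<open>F\<close>;
    divided by \<open>N\<close> they are the wanted coefficients.\<close>
  let ?b = "\<lambda>g. \<Sum>u\<in>UNIV. \<Sum>w\<in>UNIV. cnj (error_op E g $ u $ w) * F $ u $ w"
  let ?k = "\<lambda>x y u w i. if i \<in> S then (if x $ i = u \<and> y $ i = w then of_nat CARD('m) else 0)
        else (if x $ i = y $ i \<and> u = w then 1 else 0 :: complex)"
  obtain A where A: "\<And>x y. F $ x $ y =
        (if \<forall>i. i \<notin> S \<longrightarrow> x $ i = y $ i
         then A (restrict (($) x) S) (restrict (($) y) S) else 0)"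
    using F by (auto simp: acts_only_on_def)
  have "(\<Sum>g\<in>?G. ?b g * error_op E g $ x $ y) = N * F $ x $ y" for x y
  proof -
    have "(\<Sum>g\<in>?G. ?b g * error_op E g $ x $ y) =
       (\<Sum>g\<in>?G. \<Sum>u\<in>UNIV. \<Sum>w\<in>UNIV. F $ u $ w * (error_op E g $ x $ y * cnj (error_op E g $ u $ w)))"
      by (simp add: sum_distrib_right sum_distrib_left mult_ac)
    also have "\<dots> = (\<Sum>u\<in>UNIV. \<Sum>w\<in>UNIV. F $ u $ w *
        (\<Sum>g\<in>?G. error_op E g $ x $ y * cnj (error_op E g $ u $ w)))"
      by (simp add: sum.swap[of _ _ ?G] sum_distrib_left)
    also have "\<dots> = (\<Sum>u\<in>UNIV. \<Sum>w\<in>UNIV. F $ u $ w * (\<Prod>i\<in>UNIV. ?k x y (u $ i) (w $ i) i))"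
      by (simp only: error_op_complete_on[OF neb])
    \<comment> \<open>Where the kernel is nonzero, \<open>u\<close> and \<open>w\<close> agree with
      \<open>x\<close> and \<open>y\<close> on \<open>S\<close>, while \<open>x = y\<close> and
      \<open>u = w\<close> hold outside \<open>S\<close>; both entries of \<open>F\<close> are then
      the same value of \<open>A\<close>. This frees \<open>F\<close> from the summation
      variables.\<close>
    also have "\<dots> = (\<Sum>u\<in>UNIV. \<Sum>w\<in>UNIV. F $ x $ y * (\<Prod>i\<in>UNIV. ?k x y (u $ i) (w $ i) i))"
    proof (intro sum.cong refl)
      fix u w :: "'m ^ 'n"
      show "F $ u $ w * (\<Prod>i\<in>UNIV. ?k x y (u $ i) (w $ i) i)
          = F $ x $ y * (\<Prod>i\<in>UNIV. ?k x y (u $ i) (w $ i) i)"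
      proof (cases "\<forall>i. ?k x y (u $ i) (w $ i) i \<noteq> 0")
        case True
        hence "\<And>i. i \<in> S \<Longrightarrow> x $ i = u $ i \<and> y $ i = w $ i"
          "\<And>i. i \<notin> S \<Longrightarrow> x $ i = y $ i \<and> u $ i = w $ i"
          by (metis)+
        moreover from this have "restrict (($) x) S = restrict (($) u) S"
          "restrict (($) y) S = restrict (($) w) S" by auto
        ultimately have "F $ u $ w = F $ x $ y" by (simp add: A)
        thus ?thesis by simp
      next
        case False
        hence "(\<Prod>i\<in>UNIV. ?k x y (u $ i) (w $ i) i) = 0"
          by (intro prod_zero) auto
        thus ?thesis by (simp only: mult_zero_right)
      qed
    qed
    also have "\<dots> = F $ x $ y * (\<Sum>u\<in>UNIV. \<Sum>w\<in>UNIV. \<Prod>i\<in>UNIV. ?k x y (u $ i) (w $ i) i)"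
      by (simp only: sum_distrib_left)
    also have "(\<Sum>u\<in>(UNIV::('m^'n) set). \<Sum>w\<in>(UNIV::('m^'n) set). \<Prod>i\<in>UNIV. ?k x y (u $ i) (w $ i) i)
        = (\<Sum>u\<in>(UNIV::('m^'n) set). \<Prod>i\<in>UNIV. \<Sum>w\<in>UNIV. ?k x y (u $ i) w i)"
      by (intro sum.cong refl) (rule sum_words_prod_UNIV)
    also have "\<dots> = (\<Prod>i\<in>UNIV. \<Sum>u\<in>UNIV. \<Sum>w\<in>UNIV. ?k x y u w i)"
      by (rule sum_words_prod_UNIV)
    \<comment> \<open>A position in \<open>S\<close> has one pair of letters of value m; any other
      position with equal letters has m pairs of value 1.\<close>
    also have "\<dots> = (\<Prod>i\<in>UNIV. of_nat CARD('m) * (if i \<in> S \<or> x $ i = y $ i then 1 else 0))"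
    proof (intro prod.cong refl)
      fix i
      have "(\<Sum>u\<in>UNIV. \<Sum>w\<in>UNIV. if x $ i = u \<and> y $ i = w then of_nat CARD('m) else (0::complex))
        = (\<Sum>u\<in>UNIV. if x $ i = u then of_nat CARD('m) else 0)"
        by (intro sum.cong) auto
      thus "(\<Sum>u\<in>UNIV. \<Sum>w\<in>UNIV. ?k x y u w i) = of_nat CARD('m) * (if i \<in> S \<or> x $ i = y $ i then 1 else 0)"
        by (cases "i \<in> S") auto
    qed
    \<comment> \<open>If \<open>x\<close> and \<open>y\<close> differ outside \<open>S\<close>, both
      sides vanish because \<open>F $ x $ y = 0\<close>.\<close>
    also have "F $ x $ y * \<dots> = N * F $ x $ y"
      by (auto simp: N_def A prod.distrib intro!: prod.neutral)
    finally show ?thesis .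
  qed
  hence "F = (\<Sum>g\<in>?G. (?b g / N) \<cdot> error_op E g)"
    using N by (simp add: vec_eq_iff sum_divide_distrib[symmetric])
  thus ?thesis by (rule that)
qed

text \<open>Outside the support every factor is the identity \<open>E 0\<close>, whose entries test
  equality of letters.\<close>

lemma acts_only_on_error_op:
  assumes "nice_error_basis E"
  shows "acts_only_on {i. g $ i \<noteq> 0} (error_op E g)"
proof -
  let ?S = "{i. g $ i \<noteq> 0}"
  have "error_op E g $ x $ y = (if \<forall>i. i \<notin> ?S \<longrightarrow> x $ i = y $ i
         then (\<lambda>r s. \<Prod>i\<in>?S. E (g $ i) $ r i $ s i) (restrict (($) x) ?S) (restrict (($) y) ?S) else 0)"
    (is "_ = ?R") for x y
  proof -
    have "error_op E g $ x $ y = (\<Prod>i\<in>?S. E (g $ i) $ (x $ i) $ (y $ i)) *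
        (\<Prod>i\<in>- ?S. if x $ i = y $ i then 1 else 0)"
      unfolding error_op_nth
      using assms by (subst prod.subset_diff[of ?S]) (auto simp: nice_error_basis_def mat_def
          Compl_eq_Diff_UNIV mult.commute intro!: arg_cong2[where f = "(*)"] prod.cong)
    also have "\<dots> = ?R"
      by (auto simp: prod_zero_iff)
    finally show ?thesis .
  qed
  thus ?thesis unfolding acts_only_on_def
    by (intro exI[of _ "\<lambda>r s. \<Prod>i\<in>?S. E (g $ i) $ r i $ s i"]) blast
qed

text \<open>Parseval's identity: completeness for \<open>S = UNIV\<close> contracts the two traces
  into one. It evaluates both \<open>M\<close> and the coefficients of the transform.\<close>

lemma sum_trace_error_op:
  fixes E :: "'g::{ab_group_add, finite} \<Rightarrow> complex ^ 'm ^ 'm::finite"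
    and A B :: "('m, 'n::finite) operator"
  assumes "nice_error_basis E"
  shows "(\<Sum>g\<in>UNIV. trace (error_op E g ** A) * trace ((error_op E g)\<^sup>\<dagger> ** B))
    = of_nat (CARD('m) ^ CARD('n)) * trace (A ** B)"
proof -
  have comp: "(\<Sum>g\<in>UNIV. error_op E g $ x $ y * cnj (error_op E g $ u $ w))
      = (if x = u \<and> y = w then of_nat (CARD('m) ^ CARD('n)) else 0)" for x y u w :: "'m ^ 'n"
  proof -
    have "(\<Prod>i\<in>UNIV. if x $ i = u $ i \<and> y $ i = w $ i then of_nat CARD('m) else 0)
        = (\<Prod>i\<in>UNIV. of_nat CARD('m) * ((if x $ i = u $ i then 1 else 0) * (if y $ i = w $ i then 1 else (0::complex))))"
      by (intro prod.cong) auto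
    also have "\<dots> = (if x = u \<and> y = w then of_nat (CARD('m) ^ CARD('n)) else 0)"
      by (simp add: prod.distrib prod_delta_words)
    finally show ?thesis
      using error_op_complete_on[OF assms, where S = UNIV and x = x and y = y and u = u and w = w] by simp
  qed
  have "(\<Sum>g\<in>UNIV. trace (error_op E g ** A) * trace ((error_op E g)\<^sup>\<dagger> ** B)) =
    (\<Sum>g\<in>UNIV. \<Sum>w\<in>UNIV. \<Sum>x\<in>UNIV. \<Sum>u\<in>UNIV. \<Sum>y\<in>UNIV.
       A $ y $ x * B $ u $ w * (error_op E g $ x $ y * cnj (error_op E g $ u $ w)))"
    by (simp add: trace_def matrix_mult_nth sum_distrib_left sum_distrib_right mult_ac)
  also have "\<dots> = (\<Sum>w\<in>UNIV. \<Sum>x\<in>UNIV. \<Sum>u\<in>UNIV. \<Sum>y\<in>UNIV.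
       A $ y $ x * B $ u $ w * (\<Sum>g\<in>UNIV. error_op E g $ x $ y * cnj (error_op E g $ u $ w)))"
    by (simp add: sum.swap[of _ _ "UNIV :: ('g ^ 'n) set"] sum_distrib_left)
  also have "\<dots> = (\<Sum>w\<in>UNIV. \<Sum>x\<in>UNIV. \<Sum>u\<in>UNIV. \<Sum>y\<in>UNIV.
       if y = w then (if u = x then A $ y $ x * B $ u $ w * of_nat (CARD('m) ^ CARD('n)) else 0) else 0)"
    unfolding comp by (intro sum.cong) auto
  also have "\<dots> = of_nat (CARD('m) ^ CARD('n)) * trace (A ** B)"
    by (simp add: trace_def matrix_mult_nth sum_distrib_left mult_ac)
  finally show ?thesis .
qed

section \<open>Orthogonal projections and orthonormal bases\<close>

lemma matrix_add_rdistrib: "(A + B) ** C = A ** C + B ** C"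
  for A B C :: "complex ^ 'a ^ 'a::finite"
  by (simp add: vec_eq_iff matrix_mult_nth distrib_right sum.distrib)

lemma matrix_diff_ldistrib: "A ** (B - C) = A ** B - A ** C"
  for A B C :: "complex ^ 'a ^ 'a::finite"
  by (simp add: vec_eq_iff matrix_mult_nth right_diff_distrib sum_subtractf)

lemma matrix_diff_rdistrib: "(A - B) ** C = A ** C - B ** C"
  for A B C :: "complex ^ 'a ^ 'a::finite"
  by (simp add: vec_eq_iff matrix_mult_nth left_diff_distrib sum_subtractf)

text \<open>Projections with equal ranges absorb each other, \<open>P ** P' = P'\<close> and
  \<open>P' ** P = P\<close>; the adjoint of one equation gives the other product. This justifies
  the definite description in \<open>orthogonal_projection\<close>.\<close>

lemma orthogonal_projection_unique:
  fixes P P' :: "complex ^ 'a ^ 'a::finite"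
  assumes P: "is_orthogonal_projection P S" and P': "is_orthogonal_projection P' S"
  shows "P = P'"
proof -
  have absorb: "A ** B = B" if A: "is_orthogonal_projection A S" and B: "is_orthogonal_projection B S"
    for A B :: "complex ^ 'a ^ 'a"
  proof -
    have "(A ** B) *v x = B *v x" for x
    proof -
      have "B *v x \<in> range ((*v) A)" using A B by (auto simp: is_orthogonal_projection_def)
      then obtain y where "B *v x = A *v y" by auto
      thus ?thesis
        using A by (simp add: is_orthogonal_projection_def matrix_vector_mul_assoc
            matrix_vector_mul_assoc[symmetric, of A B])
    qed
    thus ?thesis by (simp add: matrix_eq)
  qed
  have "P = P\<^sup>\<dagger>" "P' = P'\<^sup>\<dagger>" using P P' by (simp_all add: is_orthogonal_projection_def)
  moreover have "(P' ** P)\<^sup>\<dagger> = P\<^sup>\<dagger> ** P'\<^sup>\<dagger>" by (rule dagger_mult)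
  ultimately show ?thesis using absorb[OF P P'] absorb[OF P' P] by metis
qed

lemma orthogonal_projection_eq:
  fixes P :: "complex ^ 'a ^ 'a::finite"
  assumes "is_orthogonal_projection P S"
  shows "orthogonal_projection S = P"
  unfolding orthogonal_projection_def
  using assms by (rule the_equality) (rule orthogonal_projection_unique[OF _ assms])

lemma ketbra_nth [simp]: "ketbra v w $ x $ y = v $ x * cnj (w $ y)"
  by (simp add: ketbra_def)

lemma sum_ketbra_mult_vec: "(\<Sum>i<K. ketbra (v i) (v i)) *v x = (\<Sum>i<K. braket (v i) x *s v i)"
  for K :: nat and v :: "nat \<Rightarrow> complex ^ 'a::finite"
  by (simp add: vec_eq_iff matrix_vector_mult_def braket_def sum_distrib_right
      sum_distrib_left mult_ac sum.swap[of _ "UNIV :: 'a set"])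

lemma trace_mult_sum_ketbra:
  fixes K :: nat and v :: "nat \<Rightarrow> complex ^ 'a::finite"
  shows "trace (A ** (\<Sum>i<K. ketbra (v i) (v i))) = (\<Sum>i<K. braket (v i) (A *v v i))"
  by (simp add: trace_def matrix_mult_nth matrix_vector_mult_def braket_def
      sum_distrib_left mult_ac sum.swap[of _ "{..<K}"])

text \<open>By orthonormality the operator fixes every basis vector, hence all of \<open>S\<close>,
  and its values lie in \<open>S\<close>; idempotence and the range follow.\<close>

lemma is_orthogonal_projection_sum_ketbra:
  fixes v :: "nat \<Rightarrow> complex ^ 'a::finite"
  assumes "orthonormal_basis v K S"
  shows "is_orthogonal_projection (\<Sum>i<K. ketbra (v i) (v i)) S"
proof -
  let ?P = "\<Sum>i<K. ketbra (v i) (v i)"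
  have span: "vec.span (v ` {..<K}) = S" using assms by (simp add: orthonormal_basis_def)
  have dag: "?P\<^sup>\<dagger> = ?P" by (simp add: vec_eq_iff mult.commute)
  have Pv: "?P *v v j = v j" if "j < K" for j
  proof -
    have "?P *v v j = (\<Sum>i<K. (if i = j then 1 else 0) *s v i)"
      unfolding sum_ketbra_mult_vec
      using assms that by (intro sum.cong) (auto simp: orthonormal_basis_def)
    also have "\<dots> = (\<Sum>i<K. if i = j then v i else 0)" by (intro sum.cong) auto
    finally show ?thesis using that by simp
  qed
  have "vec.subspace {x. ?P *v x = x}"
    by (rule vec.subspaceI) (simp_all add: matrix_vector_right_distrib vector_scalar_commute)
  moreover have "v ` {..<K} \<subseteq> {x. ?P *v x = x}" using Pv by auto
  ultimately have fixed: "S \<subseteq> {x. ?P *v x = x}"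
    unfolding span[symmetric] by (rule vec.span_minimal[rotated])
  have into: "?P *v x \<in> S" for x
    unfolding sum_ketbra_mult_vec span[symmetric]
    by (intro vec.span_sum vec.span_scale vec.span_base) auto
  have "?P ** ?P = ?P"
    using into fixed by (auto simp: matrix_eq matrix_vector_mul_assoc[symmetric])
  moreover have "range ((*v) ?P) = S"
  proof (intro equalityI subsetI)
    show "x \<in> range ((*v) ?P)" if "x \<in> S" for x
      using fixed that by (intro range_eqI[of _ _ x]) auto
  qed (use into in auto)
  ultimately show ?thesis using dag by (simp add: is_orthogonal_projection_def)
qed

lemma trace_sum_ketbra:
  fixes v :: "nat \<Rightarrow> complex ^ 'a::finite"
  assumes "orthonormal_basis v K S"
  shows "trace (\<Sum>i<K. ketbra (v i) (v i)) = of_nat K"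
proof -
  have "trace (mat 1 ** (\<Sum>i<K. ketbra (v i) (v i))) = of_nat K"
    unfolding trace_mult_sum_ketbra
    using assms by (simp add: orthonormal_basis_def)
  thus ?thesis by simp
qed

section \<open>Compressions to the code space\<close>

text \<open>
  \<open>R\<close> is the deviation of the compression \<open>P A P\<close> from its orthogonal projection onto the
  multiples of \<open>P\<close> in the Hilbert--Schmidt inner product.
\<close>

lemma compression_residual:
  fixes A P :: "complex ^ 'a ^ 'a::finite"
  assumes "P\<^sup>\<dagger> = P" "P ** P = P" "trace P = of_nat K" "K > 0"
  defines "R \<equiv> P ** A ** P - (trace (A ** P) / of_nat K) \<cdot> P"
  shows "trace (R\<^sup>\<dagger> ** R) = trace (P ** A ** P ** A\<^sup>\<dagger>) - trace (A ** P) * trace (A\<^sup>\<dagger> ** P) / of_nat K"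
proof -
  define l where "l = trace (A ** P) / of_nat K"
  define k :: complex where "k = of_nat K"
  have k: "k \<noteq> 0" using assms(4) by (simp add: k_def)
  have R: "R = P ** A ** P - l \<cdot> P" by (simp add: R_def l_def)
  have Rd: "R\<^sup>\<dagger> = P ** A\<^sup>\<dagger> ** P - cnj l \<cdot> P"
    by (simp add: R dagger_diff dagger_scale dagger_mult assms matrix_mul_assoc)
  have PX: "X ** P ** P = X ** P" for X by (simp add: matrix_mul_assoc[symmetric] assms)
  have tdA: "trace (A\<^sup>\<dagger> ** P) = cnj (trace (A ** P))"
    by (subst trace_mul_sym) (simp flip: trace_dagger add: dagger_mult assms)
  have t1: "trace (P ** A\<^sup>\<dagger> ** P ** A ** P) = trace (P ** A ** P ** A\<^sup>\<dagger>)"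
  proof -
    have "trace ((P ** A\<^sup>\<dagger>) ** (P ** A ** P)) = trace (P ** A ** P ** P ** A\<^sup>\<dagger>)"
      by (subst trace_mul_sym) (simp add: matrix_mul_assoc)
    thus ?thesis by (simp add: PX matrix_mul_assoc)
  qed
  have t2: "trace (P ** X ** P) = trace (X ** P)" for X
  proof -
    have "trace (P ** (X ** P)) = trace (X ** P ** P)" by (rule trace_mul_sym)
    thus ?thesis by (simp add: PX matrix_mul_assoc)
  qed
  have "R\<^sup>\<dagger> ** R = P ** A\<^sup>\<dagger> ** P ** A ** P - l \<cdot> (P ** A\<^sup>\<dagger> ** P) - cnj l \<cdot> (P ** A ** P) + (cnj l * l) \<cdot> P"
    unfolding Rd unfolding R
    by (simp add: matrix_diff_ldistrib matrix_diff_rdistrib scale_mult_left scale_mult_right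
        scale_diff matrix_mul_assoc PX assms mult.commute)
  hence "trace (R\<^sup>\<dagger> ** R) = trace (P ** A ** P ** A\<^sup>\<dagger>) - l * cnj (trace (A ** P))
      - cnj l * trace (A ** P) + cnj l * l * k"
    by (simp add: trace_add trace_sub trace_scale t1 t2 tdA assms k_def)
  \<comment> \<open>All three terms with \<open>l\<close> equal |tr(AP)|^2 / K up to sign; one
    negative copy survives.\<close>
  thus ?thesis using k by (simp add: tdA l_def k_def[symmetric])
qed

text \<open>Taking traces forces \<open>\<mu>\<close> to be tr(AP) / K, so a scalar compression has
  zero residual. Conversely, the trace equality says that the residual has Hilbert-Schmidt norm
  zero.\<close>

lemma compression_scalar_iff:
  fixes A P :: "complex ^ 'a ^ 'a::finite"
  assumes "P\<^sup>\<dagger> = P" "P ** P = P" "trace P = of_nat K" "K > 0"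
  shows "(\<exists>\<mu>. P ** A ** P = \<mu> \<cdot> P) \<longleftrightarrow>
    trace (A ** P) * trace (A\<^sup>\<dagger> ** P) / of_nat K = trace (P ** A ** P ** A\<^sup>\<dagger>)"
proof
  assume "\<exists>\<mu>. P ** A ** P = \<mu> \<cdot> P"
  then obtain \<mu> where \<mu>: "P ** A ** P = \<mu> \<cdot> P" ..
  have "trace (A ** P) = trace (P ** A ** P)"
    using trace_mul_sym[of "A ** P" P] assms(2)
    by (simp add: matrix_mul_assoc[symmetric])
  hence "trace (A ** P) / of_nat K = \<mu>" using assms by (simp add: \<mu> trace_scale)
  hence R: "P ** A ** P - (trace (A ** P) / of_nat K) \<cdot> P = 0" using \<mu> by simp
  show "trace (A ** P) * trace (A\<^sup>\<dagger> ** P) / of_nat K = trace (P ** A ** P ** A\<^sup>\<dagger>)"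
    using compression_residual[OF assms, of A] unfolding R by simp (simp add: trace_def)
next
  assume "trace (A ** P) * trace (A\<^sup>\<dagger> ** P) / of_nat K = trace (P ** A ** P ** A\<^sup>\<dagger>)"
  hence "P ** A ** P - (trace (A ** P) / of_nat K) \<cdot> P = 0"
    using compression_residual[OF assms, of A] by (intro trace_dagger_mult_self_eq_0) simp
  thus "\<exists>\<mu>. P ** A ** P = \<mu> \<cdot> P" by auto
qed

section \<open>Linearity of detection and the minimum distance\<close>

lemma compression_sum:
  fixes P :: "complex ^ 'a ^ 'a::finite"
  shows "P ** (\<Sum>g\<in>X. a g \<cdot> F g) ** P = (\<Sum>g\<in>X. a g \<cdot> (P ** F g ** P))"
  by (induction X rule: infinite_finite_induct)
    (simp_all add: matrix_add_ldistrib matrix_add_rdistrib scale_mult_left scale_mult_right)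

lemma sum_scale_op: "(\<Sum>g\<in>X. (a g \<cdot> P)) = (\<Sum>g\<in>X. a g) \<cdot> P"
  for P :: "complex ^ 'a ^ 'a::finite"
  by (simp add: vec_eq_iff sum_distrib_right)

lemma detects_sum:
  fixes Q :: "('m::finite, 'n::finite) state set"
  assumes "\<And>g. g \<in> X \<Longrightarrow> detects Q (F g)"
  shows "detects Q (\<Sum>g\<in>X. a g \<cdot> F g)"
proof -
  let ?P = "orthogonal_projection Q"
  obtain \<mu> where \<mu>: "\<And>g. g \<in> X \<Longrightarrow> ?P ** F g ** ?P = \<mu> g \<cdot> ?P"
    using assms unfolding detects_def Let_def by metis
  have "?P ** (\<Sum>g\<in>X. a g \<cdot> F g) ** ?P = (\<Sum>g\<in>X. a g * \<mu> g) \<cdot> ?P"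
    unfolding compression_sum sum_scale_op[symmetric] by (intro sum.cong) (simp_all add: \<mu>)
  thus ?thesis unfolding detects_def Let_def by blast
qed

lemma trace_sum: "trace (\<Sum>g\<in>X. F g) = (\<Sum>g\<in>X. trace (F g))"
  for F :: "_ \<Rightarrow> complex ^ 'a ^ 'a::finite"
  by (simp add: trace_def sum.swap[of _ X])

lemma detects_purely_sum:
  fixes Q :: "('m::finite, 'n::finite) state set"
  assumes "\<And>g. g \<in> X \<Longrightarrow> detects_purely Q (F g)"
  shows "detects_purely Q (\<Sum>g\<in>X. a g \<cdot> F g)"
  unfolding detects_purely_def Let_def compression_sum trace_sum trace_scale sum_divide_distrib
    sum_scale_op[symmetric]
  using assms by (intro sum.cong) (simp_all add: detects_purely_def Let_def)

text \<open>An undetected error operator acts only on its support, so its weight is at least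
  \<open>d\<close>. Conversely, an undetected \<open>F\<close> on \<open>d\<close> systems is a
  combination of error operators supported there, and by linearity one of them is
  undetected.\<close>

lemma quantum_code_minimum:
  fixes Q :: "('m::finite, 'n::finite) state set"
    and E :: "'g::{ab_group_add, finite} \<Rightarrow> complex ^ 'm ^ 'm"
  assumes code: "quantum_code Q K d" and neb: "nice_error_basis E"
  shows "is_minimum d {wt g | g :: 'g ^ 'n.
    \<not> (if K = 1 then detects_purely Q else detects Q) (error_op E g)}"
proof -
  let ?D = "if K = 1 then detects_purely Q else detects Q"
  from code have small: "\<And>S F. card S < d \<Longrightarrow> acts_only_on S F \<Longrightarrow> ?D F"
    by (auto simp: quantum_code_def Let_def)
  from code obtain S F where S: "card S = d" "acts_only_on S F" "\<not> ?D F"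
    by (auto simp: quantum_code_def Let_def)
  have lower: "d \<le> wt g" if "\<not> ?D (error_op E g)" for g :: "'g ^ 'n"
    unfolding wt_def using small[OF _ acts_only_on_error_op[OF neb, of g]] that by (meson not_le)
  obtain a where F: "F = (\<Sum>g\<in>{g. \<forall>i. i \<notin> S \<longrightarrow> g $ i = 0}. a g \<cdot> error_op E g)"
    using acts_only_on_expansion[OF neb S(2)] .
  have "\<exists>g\<in>{g. \<forall>i. i \<notin> S \<longrightarrow> g $ i = 0}. \<not> ?D (error_op E g)"
  proof (rule ccontr)
    assume "\<not> ?thesis"
    hence "?D F" unfolding F by (cases "K = 1") (auto intro!: detects_sum detects_purely_sum)
    with S show False by simp
  qed
  then obtain g :: "'g ^ 'n" where g: "\<forall>i. i \<notin> S \<longrightarrow> g $ i = 0" "\<not> ?D (error_op E g)" by blast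
  have "wt g \<le> card S" unfolding wt_def using g(1) by (intro card_mono) auto
  with lower[OF g(2)] S have "wt g = d" by simp
  with g(2) lower show ?thesis unfolding is_minimum_def by blast
qed

section \<open>The transform and the two claims about the code\<close>

lemma lookup_sum_zpow:
  "Poly_Mapping.lookup (\<Sum>g\<in>UNIV. c g \<odot> zpow g) = (c :: 'g::finite ^ 'n::finite \<Rightarrow> complex)"
  by (rule ext) (simp add: lookup_sum scale_alg_def zpow_def Poly_Mapping.map.rep_eq lookup_single
      when_def if_distrib)

lemma lookup_scale_alg: "Poly_Mapping.lookup (a \<odot> C) g = a * Poly_Mapping.lookup C g"
  by (simp add: scale_alg_def Poly_Mapping.map.rep_eq when_def)

theorem mainTheorem1:
  fixes Q :: "('m::finite, 'n::finite) state set"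
    and E :: "'g::{ab_group_add, finite} \<Rightarrow> complex ^ 'm ^ 'm"
    and v :: "nat \<Rightarrow> ('m, 'n) state"
    and P :: "('m, 'n) operator"
    and K d :: nat
    and c c' :: "'g ^ 'n \<Rightarrow> complex"
    and C C' :: "('g, 'n) group_algebra"
    and M :: complex
  assumes code: "quantum_code Q K d"
    and basis: "orthonormal_basis v K Q"
    and P: "P = (\<Sum>i<K. ketbra (v i) (v i))"
    and neb: "nice_error_basis E"
    and c: "\<And>g. c g = 1 / (of_nat K)\<^sup>2 *
              (trace (error_op E g ** P\<^sup>\<dagger>) * trace ((error_op E g)\<^sup>\<dagger> ** P))"
    and C: "C = (\<Sum>g\<in>UNIV. c g \<odot> zpow g)"
    and M: "M = (\<Sum>g\<in>UNIV. c g)"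
    and C': "C' = transform E C"
    and c': "c' = Poly_Mapping.lookup C'"
  shows "is_orthogonal_projection P Q \<and>
    (\<forall>g. c g = of_real (1 / (real K)\<^sup>2 *
            (cmod (\<Sum>i<K. braket (v i) (error_op E g *v v i)))\<^sup>2)) \<and>
    of_nat K = of_nat (CARD('m) ^ CARD('n)) / M \<and>
    (K > 1 \<longrightarrow> is_minimum d {wt g | g. c g \<noteq> c' g}) \<and>
    (K = 1 \<longrightarrow> is_minimum d {wt g | g. wt g \<noteq> 0 \<and> c g \<noteq> 0})"
proof -
  let ?E = "error_op E :: 'g ^ 'n \<Rightarrow> _"
  define k :: complex where "k = of_nat K"
  define N :: complex where "N = of_nat (CARD('m) ^ CARD('n))"
  have N: "N \<noteq> 0" by (simp add: N_def)
  have proj: "is_orthogonal_projection P Q"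
    unfolding P by (rule is_orthogonal_projection_sum_ketbra[OF basis])
  hence Pd: "P\<^sup>\<dagger> = P" and PP: "P ** P = P" by (simp_all add: is_orthogonal_projection_def)
  have op: "orthogonal_projection Q = P" by (rule orthogonal_projection_eq[OF proj])
  have trP: "trace P = k" unfolding P k_def by (rule trace_sum_ketbra[OF basis])
  \<comment> \<open>For \<open>K = 0\<close> the projection is zero and detects every operator,
    contradicting the undetected error that \<open>quantum_code\<close> provides.\<close>
  have K: "K > 0"
  proof (rule ccontr)
    assume "\<not> K > 0"
    hence K0: "K = 0" and "P = 0" by (simp_all add: P)
    hence "detects Q F" for F
      unfolding detects_def op Let_def by (intro exI[of _ 0]) (simp add: vec_eq_iff matrix_mult_nth)
    with code K0 show False by (auto simp: quantum_code_def)
  qed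
  hence k: "k \<noteq> 0" by (simp add: k_def)
  have cg: "c g = trace (?E g ** P) * trace ((?E g)\<^sup>\<dagger> ** P) / k\<^sup>2" for g
    by (simp add: c Pd k_def)
  \<comment> \<open>Since \<open>P\<close> is self-adjoint, the two traces in \<open>c g\<close> are
    conjugate, so \<open>c g\<close> is a squared modulus.\<close>
  have tr_dag: "trace ((?E g)\<^sup>\<dagger> ** P) = cnj (trace (?E g ** P))" for g
    by (subst trace_mul_sym) (simp flip: trace_dagger add: dagger_mult Pd)
  have c_real: "c g = of_real (1 / (real K)\<^sup>2 *
            (cmod (\<Sum>i<K. braket (v i) (?E g *v v i)))\<^sup>2)" for g
  proof -
    have "trace (?E g ** P) = (\<Sum>i<K. braket (v i) (?E g *v v i))"
      unfolding P by (rule trace_mult_sum_ketbra)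
    moreover have "c g = of_real (1 / (real K)\<^sup>2 * (cmod (trace (?E g ** P)))\<^sup>2)"
      by (simp add: cg tr_dag k_def complex_norm_square del: of_real_power) simp
    ultimately show ?thesis by simp
  qed
  have transf: "(\<Sum>g\<in>UNIV. c g * group_char E h g) = N * trace (P ** ?E h ** P ** (?E h)\<^sup>\<dagger>) / k\<^sup>2" for h
  proof -
    \<comment> \<open>The character is absorbed by conjugating with \<open>?E h\<close>, and
      cyclicity moves the conjugation onto \<open>P\<close>; Parseval's identity then
      applies.\<close>
    have "group_char E h g * trace ((?E g)\<^sup>\<dagger> ** P) = trace ((?E g)\<^sup>\<dagger> ** (?E h ** P ** (?E h)\<^sup>\<dagger>))" for g
    proof -
      have "group_char E h g * trace ((?E g)\<^sup>\<dagger> ** P) = trace ((?E h)\<^sup>\<dagger> ** ((?E g)\<^sup>\<dagger> ** ?E h ** P))"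
        using error_op_conj[OF neb, of h g]
        by (simp add: matrix_mul_assoc scale_mult_left trace_scale)
      also have "\<dots> = trace ((?E g)\<^sup>\<dagger> ** ?E h ** P ** (?E h)\<^sup>\<dagger>)" by (rule trace_mul_sym)
      finally show ?thesis by (simp add: matrix_mul_assoc)
    qed
    hence "c g * group_char E h g
        = trace (?E g ** P) * trace ((?E g)\<^sup>\<dagger> ** (?E h ** P ** (?E h)\<^sup>\<dagger>)) / k\<^sup>2" for g
      by (simp add: cg mult_ac)
    thus ?thesis
      using sum_trace_error_op[OF neb, of P "?E h ** P ** (?E h)\<^sup>\<dagger>"]
      by (simp add: sum_divide_distrib[symmetric] N_def matrix_mul_assoc)
  qed
  have "M = N * trace (P ** P) / k\<^sup>2"
    using sum_trace_error_op[OF neb, of P P]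
    by (simp add: M cg sum_divide_distrib[symmetric] N_def)
  hence M_eq: "M = N / k" using k by (simp add: PP trP power2_eq_square)
  have c'_eq: "c' h = trace (P ** ?E h ** P ** (?E h)\<^sup>\<dagger>) / k" for h
  proof -
    have "c' h = (1 / M) * (\<Sum>g\<in>UNIV. c g * group_char E h g)"
      by (simp add: c' C' transform_def lookup_scale_alg lookup_sum_zpow coeff_sum_def char_alg_def
          C M)
    thus ?thesis unfolding transf M_eq using k N by (simp add: power2_eq_square)
  qed
  \<comment> \<open>The criterion of \<open>compression_scalar_iff\<close>, divided by K, compares
    exactly \<open>c g\<close> with \<open>c' g\<close>.\<close>
  have detects_iff: "detects Q (?E g) \<longleftrightarrow> c g = c' g" for g
    unfolding detects_def op Let_def
      compression_scalar_iff[OF Pd PP trP[unfolded k_def] K, of "?E g"]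
    using k by (simp add: cg c'_eq k_def[symmetric] power2_eq_square field_simps)
  have pure_iff: "detects_purely Q (?E g) \<longleftrightarrow> g = 0 \<or> c g = 0" if "K = 1" for g
  proof (cases "g = 0")
    case True
    \<comment> \<open>The identity has normalized trace 1 and is always purely detected, although
      \<open>c 0\<close> is nonzero; hence weight 0 is excluded for \<open>K = 1\<close>.\<close>
    thus ?thesis
      using neb by (simp add: detects_purely_def op error_op_zero trace_mat_1 PP)
  next
    case False
    \<comment> \<open>For \<open>K = 1\<close> the projection is a single ketbra, so every
      compression is scalar.\<close>
    have "P ** A ** P = trace (A ** P) \<cdot> P" for A
      using that by (simp add: P vec_eq_iff matrix_mult_nth trace_def
          sum_distrib_left sum_distrib_right mult_ac) (intro allI sum.swap)
    \<comment> \<open>Here the error is traceless, so purity demands a zero compression;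
      \<open>P\<close> has nonzero trace, so the scalar itself must vanish.\<close>
    hence "detects_purely Q (?E g) \<longleftrightarrow> trace (?E g ** P) \<cdot> P = 0 \<cdot> P"
      by (simp add: detects_purely_def op trace_error_op[OF neb False])
    also have "\<dots> \<longleftrightarrow> trace (?E g ** P) = 0"
      using trP k by (metis trace_scale mult_cancel_right)
    finally show ?thesis using False k by (simp add: cg tr_dag)
  qed
  have "is_minimum d {wt g | g. c g \<noteq> c' g}" if "K > 1"
    using quantum_code_minimum[OF code neb] that by (simp add: detects_iff)
  moreover have "is_minimum d {wt g | g. wt g \<noteq> 0 \<and> c g \<noteq> 0}" if "K = 1"
  proof -
    have "wt g = 0 \<longleftrightarrow> g = 0" for g :: "'g ^ 'n"
      by (auto simp: wt_def vec_eq_iff)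
    thus ?thesis
      using quantum_code_minimum[OF code neb] that by (simp add: pure_iff)
  qed
  ultimately show ?thesis
    using proj c_real M_eq N k by (auto simp: N_def k_def)
qed

end
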